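(* Let $(\mathfrak h,[\cdot,\cdot]_{\mathfrak h},\phi_{\mathfrak h})$ be a Hom-Lie algebra. Consider the complex $\mathfrak h\xrightarrow{\mathsf{ad}}\mathsf{Der}(\mathfrak h)$, with $\mathfrak h$ in degree $1$ and $\mathsf{Der}(\mathfrak h)$ in degree $0$, and define $l_2$ by $$l_2(D_1,D_2)=[D_1,D_2]_{\phi_{\mathfrak h}},\qquad l_2(D,u)=-l_2(u,D)=D(u),\qquad D,D_1,D_2\in\mathsf{Der}(\mathfrak h),\ u\in\mathfrak h.$$ Then $(\mathfrak h,\mathsf{Der}(\mathfrak h),\mathrm d=\mathsf{ad},l_2,\phi_0=\mathsf{Ad}_{\phi_{\mathfrak h}},\phi_1=\phi_{\mathfrak h})$ is a strict Hom-Lie $2$-algebra.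
   Context: Vector spaces are over a fixed ground field. A Hom-Lie algebra $(\mathfrak h,[\cdot,\cdot]_{\mathfrak h},\phi_{\mathfrak h})$ is a vector space $\mathfrak h$ with a skew-symmetric bilinear bracket (a linear map on $\wedge^2\mathfrak h$) and a linear map $\phi_{\mathfrak h}:\mathfrak h\to\mathfrak h$ preserving the bracket, such that $[\phi_{\mathfrak h}(x),[y,z]_{\mathfrak h}]_{\mathfrak h}+[\phi_{\mathfrak h}(y),[z,x]_{\mathfrak h}]_{\mathfrak h}+[\phi_{\mathfrak h}(z),[x,y]_{\mathfrak h}]_{\mathfrak h}=0$. Throughout, $\phi_{\mathfrak h}$ is assumed to be an algebra automorphism. For a linear automorphism $\beta$ of a vector space $V$ and $A,B\in\mathfrak{gl}(V)$ put $\mathsf{Ad}_\beta(A)=\beta\circ A\circ\beta^{-1}$ and $[A,B]_\beta=\beta\circ A\circ\beta^{-1}\circ B\circ\beta^{-1}-\beta\circ B\circ\beta^{-1}\circ A\circ\beta^{-1}$. A derivation of $\mathfrak h$ is a linear map $D:\mathfrak h\to\mathfrak h$ with $D[u,v]_{\mathfrak h}=[\phi_{\mathfrak h}(u),(\mathsf{Ad}_{\phi_{\mathfrak h}^{-1}}D)(v)]_{\mathfrak h}+[(\mathsf{Ad}_{\phi_{\mathfrak h}^{-1}}D)(u),\phi_{\mathfrak h}(v)]_{\mathfrak h}$ for all $u,v\in\mathfrak h$; $\mathsf{Der}(\mathfrak h)$ is the set of derivations. $\mathsf{ad}_u(v)=[u,v]_{\mathfrak h}$. A Hom-Lie $2$-algebra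 $(V_1,V_0,\mathrm d,l_2,l_3,\phi_0,\phi_1)$ consists of a linear map $\mathrm d:V_1\to V_0$; bilinear maps $l_2:V_i\times V_j\to V_{i+j}$ for $0\le i+j\le1$; linear maps $\phi_0:V_0\to V_0$, $\phi_1:V_1\to V_1$ with $\phi_0\circ\mathrm d=\mathrm d\circ\phi_1$; and a skew-symmetric trilinear map $l_3:V_0\times V_0\times V_0\to V_1$ with $l_3\circ\phi_0^{\otimes3}=\phi_1\circ l_3$, such that for all $w,x,y,z\in V_0$, $m,n\in V_1$: (a) $l_2(x,y)=-l_2(y,x)$, $l_2(x,m)=-l_2(m,x)$; (b) $\mathrm d l_2(x,m)=l_2(x,\mathrm dm)$, $l_2(\mathrm dm,n)=l_2(m,\mathrm dn)$; (c) $\phi_0(l_2(x,y))=l_2(\phi_0(x),\phi_0(y))$, $\phi_1(l_2(x,m))=l_2(\phi_0(x),\phi_1(m))$; (d) $\mathrm d l_3(x,y,z)=l_2(\phi_0(x),l_2(y,z))+l_2(\phi_0(y),l_2(z,x))+l_2(\phi_0(z),l_2(x,y))$; (e) $l_3(x,y,\mathrm dm)=l_2(\phi_0(x),l_2(y,m))+l_2(\phi_0(y),l_2(m,x))+l_2(\phi_1(m),l_2(x,y))$; (f) $l_3(l_2(w,x),\phi_0(y),\phi_0(z))+l_2(l_3(w,x,z),\phi_0^2(y))+l_3(\phi_0(w),l_2(x,z),\phi_0(y))+l_3(l_2(w,z),\phi_0(x),\phi_0(y))=l_2(l_3(w,x,y),\phi_0^2(z))+l_3(l_2(w,y),\phi_0(x),\phi_0(z))+l_3(\phi_0(w),l_2(x,y),\phi_0(z))+l_2(\phi_0^2(w),l_3(x,y,z))+l_2(l_3(w,y,z),\phi_0^2(x))+l_3(\phi_0(w),l_2(y,z),\phi_0(x))$.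 It is strict if $l_3=0$; then $l_3$ is omitted from the notation. *)

theory Defs
  imports Complex_Main "HOL-Library.Function_Algebras"
begin

text \<open>
  A vector space is given by a type of class \<open>ab_group_add\<close> with a scalar multiplication satisfying
  the library locale \<^locale>\<open>vector_space\<close>. Spaces that are not a whole type, such as
  the derivations inside the space of all maps, are subspaces of such an ambient space; functions
  are only constrained on these subspaces.
\<close>

section \<open>Maps between subspaces\<close>

definition linear_on ::
  "('k::field \<Rightarrow> 'a::ab_group_add \<Rightarrow> 'a) \<Rightarrow> ('k \<Rightarrow> 'b::ab_group_add \<Rightarrow> 'b) \<Rightarrow>
   'a set \<Rightarrow> 'b set \<Rightarrow> ('a \<Rightarrow> 'b) \<Rightarrow> bool" where
  "linear_on s t A B f \<longleftrightarrow>
     (\<forall>x\<in>A. f x \<in> B) \<and>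
     (\<forall>x\<in>A. \<forall>y\<in>A. f (x + y) = f x + f y) \<and>
     (\<forall>c. \<forall>x\<in>A. f (s c x) = t c (f x))"

definition bilinear_on ::
  "('k::field \<Rightarrow> 'a::ab_group_add \<Rightarrow> 'a) \<Rightarrow> ('k \<Rightarrow> 'b::ab_group_add \<Rightarrow> 'b) \<Rightarrow>
   ('k \<Rightarrow> 'c::ab_group_add \<Rightarrow> 'c) \<Rightarrow>
   'a set \<Rightarrow> 'b set \<Rightarrow> 'c set \<Rightarrow> ('a \<Rightarrow> 'b \<Rightarrow> 'c) \<Rightarrow> bool" where
  "bilinear_on s t r A B C f \<longleftrightarrow>
     (\<forall>x\<in>A. linear_on t r B C (f x)) \<and>
     (\<forall>y\<in>B. linear_on s r A C (\<lambda>x. f x y))"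

definition trilinear_on ::
  "('k::field \<Rightarrow> 'a::ab_group_add \<Rightarrow> 'a) \<Rightarrow> ('k \<Rightarrow> 'b::ab_group_add \<Rightarrow> 'b) \<Rightarrow>
   'a set \<Rightarrow> 'b set \<Rightarrow> ('a \<Rightarrow> 'a \<Rightarrow> 'a \<Rightarrow> 'b) \<Rightarrow> bool" where
  "trilinear_on s t A B f \<longleftrightarrow>
     (\<forall>x\<in>A. \<forall>y\<in>A. linear_on s t A B (\<lambda>z. f x y z)) \<and>
     (\<forall>x\<in>A. \<forall>z\<in>A. linear_on s t A B (\<lambda>y. f x y z)) \<and>
     (\<forall>y\<in>A. \<forall>z\<in>A. linear_on s t A B (\<lambda>x. f x y z))"


section \<open>Hom-Lie algebras and derivations\<close>

text \<open>
  The ground field is arbitrary. A linear map on an exterior power is a multilinear map that vanishes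
  when two arguments agree, which in characteristic 2 is more than a change of sign under
  transpositions; this is the meaning given to skew-symmetry of the bracket here
  and of \<open>l3\<close> below.
\<close>

locale hom_lie_algebra = vector_space scale
  for scale :: "'k::field \<Rightarrow> 'h::ab_group_add \<Rightarrow> 'h" +
  fixes bracket :: "'h \<Rightarrow> 'h \<Rightarrow> 'h"
    and \<phi> :: "'h \<Rightarrow> 'h"
  assumes bracket_linear_right: "Vector_Spaces.linear scale scale (bracket x)"
    and bracket_linear_left: "Vector_Spaces.linear scale scale (\<lambda>x. bracket x y)"
    and bracket_alternating: "bracket x x = 0"
    and phi_linear: "Vector_Spaces.linear scale scale \<phi>"
    and phi_bracket: "\<phi> (bracket x y) = bracket (\<phi> x) (\<phi> y)"
    and hom_jacobi:
      "bracket (\<phi> x) (bracket y z) + bracket (\<phi> y) (bracket z x) + bracket (\<phi> z) (bracket x y) = 0"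

text \<open>In the next two definitions \<open>\<beta>\<close> is meant to be bijective, so that \<open>inv \<beta>\<close> is its inverse.\<close>

definition Ad :: "('h \<Rightarrow> 'h) \<Rightarrow> ('h \<Rightarrow> 'h) \<Rightarrow> ('h \<Rightarrow> 'h)" where
  "Ad \<beta> A = \<beta> \<circ> A \<circ> inv \<beta>"

definition twisted_commutator ::
  "('h::ab_group_add \<Rightarrow> 'h) \<Rightarrow> ('h \<Rightarrow> 'h) \<Rightarrow> ('h \<Rightarrow> 'h) \<Rightarrow> ('h \<Rightarrow> 'h)" where
  "twisted_commutator \<beta> A B =
     (\<beta> \<circ> A \<circ> inv \<beta> \<circ> B \<circ> inv \<beta>) - (\<beta> \<circ> B \<circ> inv \<beta> \<circ> A \<circ> inv \<beta>)"

definition Der ::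
  "('k::field \<Rightarrow> 'h::ab_group_add \<Rightarrow> 'h) \<Rightarrow> ('h \<Rightarrow> 'h \<Rightarrow> 'h) \<Rightarrow> ('h \<Rightarrow> 'h) \<Rightarrow> ('h \<Rightarrow> 'h) set" where
  "Der scale bracket \<phi> =
     {D. Vector_Spaces.linear scale scale D \<and>
         (\<forall>u v. D (bracket u v) =
            bracket (\<phi> u) (Ad (inv \<phi>) D v) + bracket (Ad (inv \<phi>) D u) (\<phi> v))}"

definition ad :: "('h \<Rightarrow> 'h \<Rightarrow> 'h) \<Rightarrow> 'h \<Rightarrow> ('h \<Rightarrow> 'h)" where
  "ad bracket u = (\<lambda>v. bracket u v)"

definition fun_scale :: "('k \<Rightarrow> 'h \<Rightarrow> 'h) \<Rightarrow> 'k \<Rightarrow> ('h \<Rightarrow> 'h) \<Rightarrow> ('h \<Rightarrow> 'h)" where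
  "fun_scale scale c f = (\<lambda>x. scale c (f x))"


section \<open>Hom-Lie 2-algebras\<close>

text \<open>
  The map \<open>l2\<close> on \<open>V\<^sub>i \<times> V\<^sub>j\<close> is split into \<open>l00\<close>, \<open>l01\<close>, \<open>l10\<close>
  according to the degrees \<open>(i, j)\<close>.
\<close>

locale hom_lie_2_algebra =
  V1: vector_space scale1 + V0: vector_space scale0
  for scale1 :: "'k::field \<Rightarrow> 'a::ab_group_add \<Rightarrow> 'a"
    and scale0 :: "'k \<Rightarrow> 'b::ab_group_add \<Rightarrow> 'b" +
  fixes V1 :: "'a set" and V0 :: "'b set"
    and d :: "'a \<Rightarrow> 'b"
    and l00 :: "'b \<Rightarrow> 'b \<Rightarrow> 'b" and l01 :: "'b \<Rightarrow> 'a \<Rightarrow> 'a" and l10 :: "'a \<Rightarrow> 'b \<Rightarrow> 'a"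
    and l3 :: "'b \<Rightarrow> 'b \<Rightarrow> 'b \<Rightarrow> 'a"
    and \<phi>0 :: "'b \<Rightarrow> 'b" and \<phi>1 :: "'a \<Rightarrow> 'a"
  assumes V1_subspace: "V1.subspace V1"
    and V0_subspace: "V0.subspace V0"
    and d_linear: "linear_on scale1 scale0 V1 V0 d"
    and l00_bilinear: "bilinear_on scale0 scale0 scale0 V0 V0 V0 l00"
    and l01_bilinear: "bilinear_on scale0 scale1 scale1 V0 V1 V1 l01"
    and l10_bilinear: "bilinear_on scale1 scale0 scale1 V1 V0 V1 l10"
    and phi0_linear: "linear_on scale0 scale0 V0 V0 \<phi>0"
    and phi1_linear: "linear_on scale1 scale1 V1 V1 \<phi>1"
    and phi_d: "m \<in> V1 \<Longrightarrow> \<phi>0 (d m) = d (\<phi>1 m)"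
    and l3_trilinear: "trilinear_on scale0 scale1 V0 V1 l3"
    and l3_alternating: "\<lbrakk>x \<in> V0; y \<in> V0\<rbrakk> \<Longrightarrow> l3 x x y = 0 \<and> l3 x y x = 0 \<and> l3 y x x = 0"
    and l3_phi: "\<lbrakk>x \<in> V0; y \<in> V0; z \<in> V0\<rbrakk> \<Longrightarrow> l3 (\<phi>0 x) (\<phi>0 y) (\<phi>0 z) = \<phi>1 (l3 x y z)"
    and l00_skew: "\<lbrakk>x \<in> V0; y \<in> V0\<rbrakk> \<Longrightarrow> l00 x y = - l00 y x"
    and l01_skew: "\<lbrakk>x \<in> V0; m \<in> V1\<rbrakk> \<Longrightarrow> l01 x m = - l10 m x"
    and d_l01: "\<lbrakk>x \<in> V0; m \<in> V1\<rbrakk> \<Longrightarrow> d (l01 x m) = l00 x (d m)"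
    and l2_d: "\<lbrakk>m \<in> V1; n \<in> V1\<rbrakk> \<Longrightarrow> l01 (d m) n = l10 m (d n)"
    and phi0_l00: "\<lbrakk>x \<in> V0; y \<in> V0\<rbrakk> \<Longrightarrow> \<phi>0 (l00 x y) = l00 (\<phi>0 x) (\<phi>0 y)"
    and phi1_l01: "\<lbrakk>x \<in> V0; m \<in> V1\<rbrakk> \<Longrightarrow> \<phi>1 (l01 x m) = l01 (\<phi>0 x) (\<phi>1 m)"
    and d_l3: "\<lbrakk>x \<in> V0; y \<in> V0; z \<in> V0\<rbrakk> \<Longrightarrow>
      d (l3 x y z) = l00 (\<phi>0 x) (l00 y z) + l00 (\<phi>0 y) (l00 z x) + l00 (\<phi>0 z) (l00 x y)"
    and l3_d: "\<lbrakk>x \<in> V0; y \<in> V0; m \<in> V1\<rbrakk> \<Longrightarrow>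
      l3 x y (d m) = l01 (\<phi>0 x) (l01 y m) + l01 (\<phi>0 y) (l10 m x) + l10 (\<phi>1 m) (l00 x y)"
    and l3_jacobiator: "\<lbrakk>w \<in> V0; x \<in> V0; y \<in> V0; z \<in> V0\<rbrakk> \<Longrightarrow>
      l3 (l00 w x) (\<phi>0 y) (\<phi>0 z) + l10 (l3 w x z) (\<phi>0 (\<phi>0 y))
        + l3 (\<phi>0 w) (l00 x z) (\<phi>0 y) + l3 (l00 w z) (\<phi>0 x) (\<phi>0 y)
      = l10 (l3 w x y) (\<phi>0 (\<phi>0 z)) + l3 (l00 w y) (\<phi>0 x) (\<phi>0 z)
        + l3 (\<phi>0 w) (l00 x y) (\<phi>0 z) + l01 (\<phi>0 (\<phi>0 w)) (l3 x y z)
        + l10 (l3 w y z) (\<phi>0 (\<phi>0 x)) + l3 (\<phi>0 w) (l00 y z) (\<phi>0 x)"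

definition strict_hom_lie_2_algebra ::
  "('k::field \<Rightarrow> 'a::ab_group_add \<Rightarrow> 'a) \<Rightarrow> ('k \<Rightarrow> 'b::ab_group_add \<Rightarrow> 'b) \<Rightarrow>
   'a set \<Rightarrow> 'b set \<Rightarrow> ('a \<Rightarrow> 'b) \<Rightarrow>
   ('b \<Rightarrow> 'b \<Rightarrow> 'b) \<Rightarrow> ('b \<Rightarrow> 'a \<Rightarrow> 'a) \<Rightarrow> ('a \<Rightarrow> 'b \<Rightarrow> 'a) \<Rightarrow>
   ('b \<Rightarrow> 'b) \<Rightarrow> ('a \<Rightarrow> 'a) \<Rightarrow> bool" where
  "strict_hom_lie_2_algebra scale1 scale0 V1 V0 d l00 l01 l10 \<phi>0 \<phi>1 \<longleftrightarrow>
     hom_lie_2_algebra scale1 scale0 V1 V0 d l00 l01 l10 (\<lambda>_ _ _. 0) \<phi>0 \<phi>1"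

end

theory Submission
  imports Defs
begin

text \<open>
  A Hom-Lie algebra with bijective \<open>\<phi>\<close> is a twisted Lie algebra: the bracket
  \<open>{u, v} = \<phi>\<inverse> [u, v]\<close> satisfies the ordinary Jacobi identity, \<open>\<phi>\<close> is an automorphism of it, and
  \<open>[u, v] = \<phi> {u, v}\<close>. Under this correspondence \<open>D\<close> is a derivation in the Hom sense exactly when
  \<open>\<phi>\<inverse> \<circ> D\<close> is a derivation of \<open>{\<cdot>, \<cdot>}\<close> in the classical sense (\<open>Der_iff_untwisted\<close>).

  Writing \<open>D = \<phi> \<circ> F\<close>, the data of the theorem become those of the classical strict Lie 2-algebra
  \<open>u \<mapsto> {u, \<cdot>}\<close> from a Lie algebra to its derivations, twisted by \<open>\<phi>\<close>: the map \<open>ad\<close> sends \<open>u\<close> to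
  \<open>{u, \<cdot>}\<close>, the action is \<open>(F, u) \<mapsto> \<phi> (F u)\<close>, the map \<open>Ad \<phi>\<close> is conjugation by \<open>\<phi>\<close>, and the
  bracket of \<open>F\<close> and \<open>G\<close> is the conjugate by \<open>\<phi>\<close> of the usual commutator. That the derivations are
  closed under these operations is therefore the classical fact, applied to \<open>F\<close>
  (\<open>ad_in_Der\<close>, \<open>Ad_in_Der\<close>, \<open>twisted_commutator_in_Der\<close>). Of the remaining identities that
  involve derivations, only \<open>ad (D u) = [D, ad u]\<close> uses the Leibniz rule
  (\<open>ad_derivation_apply\<close>); the others hold for all linear maps, because composition is associative
  and \<open>\<phi>\<close> cancels against its inverse. Those that involve only \<open>ad\<close> say that \<open>\<phi>\<close> preserves the
  bracket and that the bracket is skew-symmetric.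
\<close>

section \<open>The untwisted Lie bracket\<close>

locale regular_hom_lie_algebra = hom_lie_algebra scale bracket \<phi>
  for scale :: "'k::field \<Rightarrow> 'h::ab_group_add \<Rightarrow> 'h" and bracket and \<phi> +
  assumes phi_bij: "bij \<phi>"
begin

abbreviation \<psi> :: "'h \<Rightarrow> 'h" where "\<psi> \<equiv> inv \<phi>"

abbreviation Derivations :: "('h \<Rightarrow> 'h) set" where
  "Derivations \<equiv> Der scale bracket \<phi>"

definition untwisted_bracket :: "'h \<Rightarrow> 'h \<Rightarrow> 'h" where
  "untwisted_bracket u v = \<psi> (bracket u v)"

lemma phi_psi [simp]: "\<phi> (\<psi> x) = x"
  by (simp add: phi_bij bij_is_surj surj_f_inv_f)

lemma psi_phi [simp]: "\<psi> (\<phi> x) = x"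
  by (simp add: phi_bij bij_is_inj)

lemma inv_psi: "inv \<psi> = \<phi>"
  by (simp add: phi_bij inv_inv_eq)

lemma psi_eq_iff: "\<psi> x = y \<longleftrightarrow> x = \<phi> y"
  by (metis phi_psi psi_phi)

lemma psi_bracket: "\<psi> (bracket x y) = bracket (\<psi> x) (\<psi> y)"
  by (simp add: psi_eq_iff phi_bracket)

lemma linear_imp_module_hom:
  "Vector_Spaces.linear s t f \<Longrightarrow> module_hom s t f"
  by (simp add: Vector_Spaces.linear_iff_module_hom)

lemmas linear_rules =
  module_hom.add [OF linear_imp_module_hom]
  module_hom.diff [OF linear_imp_module_hom]
  module_hom.neg [OF linear_imp_module_hom]
  module_hom.scale [OF linear_imp_module_hom]
  module_hom.zero [OF linear_imp_module_hom]

lemmas bracket_right_rules = linear_rules [OF bracket_linear_right]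
lemmas bracket_left_rules = linear_rules [OF bracket_linear_left]
lemmas phi_rules = linear_rules [OF phi_linear]

lemma linear_endomorphismI:
  "(\<And>x y. f (x + y) = f x + f y) \<Longrightarrow> (\<And>c x. f (scale c x) = scale c (f x)) \<Longrightarrow>
   Vector_Spaces.linear scale scale f"
  by unfold_locales auto

lemma psi_linear: "Vector_Spaces.linear scale scale \<psi>"
  by (rule linear_endomorphismI) (simp_all add: psi_eq_iff phi_rules)

lemmas psi_rules = linear_rules [OF psi_linear]

lemma bracket_skew: "bracket x y = - bracket y x"
proof -
  have "bracket (x + y) (x + y) =
      bracket x x + bracket x y + (bracket y x + bracket y y)"
    by (simp only: bracket_left_rules bracket_right_rules add_ac)
  then show ?thesis by (simp add: bracket_alternating eq_neg_iff_add_eq_0)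
qed

lemma untwisted_bracket_linear_rules:
  "untwisted_bracket (x + y) z = untwisted_bracket x z + untwisted_bracket y z"
  "untwisted_bracket z (x + y) = untwisted_bracket z x + untwisted_bracket z y"
  "untwisted_bracket (x - y) z = untwisted_bracket x z - untwisted_bracket y z"
  "untwisted_bracket z (x - y) = untwisted_bracket z x - untwisted_bracket z y"
  "untwisted_bracket (scale c x) z = scale c (untwisted_bracket x z)"
  "untwisted_bracket z (scale c x) = scale c (untwisted_bracket z x)"
  "untwisted_bracket 0 z = 0"
  "untwisted_bracket z 0 = 0"
  by (simp_all add: untwisted_bracket_def psi_rules bracket_left_rules bracket_right_rules)

lemma phi_untwisted_bracket:
  "\<phi> (untwisted_bracket u v) = untwisted_bracket (\<phi> u) (\<phi> v)"
  by (simp add: untwisted_bracket_def psi_bracket phi_bracket)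

lemma psi_untwisted_bracket:
  "\<psi> (untwisted_bracket u v) = untwisted_bracket (\<psi> u) (\<psi> v)"
  by (simp add: untwisted_bracket_def psi_bracket)

text \<open>
  This is the Jacobi identity for \<open>{\<cdot>, \<cdot>}\<close>, written as a Leibniz rule: both brackets in
  \<open>{u, {v, w}} = \<phi>\<inverse> [u, \<phi>\<inverse> [v, w]]\<close> can be pulled together to \<open>\<phi>\<inverse> \<phi>\<inverse> [\<phi> u, [v, w]]\<close>.
\<close>
lemma untwisted_bracket_Leibniz:
  "untwisted_bracket u (untwisted_bracket v w) =
     untwisted_bracket v (untwisted_bracket u w) + untwisted_bracket (untwisted_bracket u v) w"
proof -
  have pull: "untwisted_bracket x (untwisted_bracket y z) = \<psi> (\<psi> (bracket (\<phi> x) (bracket y z)))"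
    for x y z by (simp add: untwisted_bracket_def psi_bracket)
  have skew: "untwisted_bracket x y = - untwisted_bracket y x" for x y
    unfolding untwisted_bracket_def by (subst bracket_skew) (simp add: psi_rules)
  have "bracket (\<phi> u) (bracket v w) =
      bracket (\<phi> v) (bracket u w) - bracket (\<phi> w) (bracket u v)"
    using hom_jacobi [of u v w] bracket_skew [of w u]
    by (simp add: bracket_right_rules algebra_simps eq_neg_iff_add_eq_0)
  then show ?thesis
    by (simp add: skew [of "untwisted_bracket u v" w] pull psi_rules)
qed


section \<open>Derivations\<close>

text \<open>
  Replacing \<open>D\<close> by \<open>\<phi> \<circ> F\<close> and the bracket by \<open>\<phi> \<circ> {\<cdot>, \<cdot>}\<close> turns the Hom-Leibniz rule for
  \<open>D\<close> into the Leibniz rule for \<open>F\<close> on the arguments \<open>\<phi> u\<close>, \<open>\<phi> v\<close>; these are arbitrary since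
  \<open>\<phi>\<close> is onto.
\<close>
lemma Der_iff_untwisted:
  "D \<in> Derivations \<longleftrightarrow>
     Vector_Spaces.linear scale scale D \<and>
     (\<forall>u v. \<psi> (D (untwisted_bracket u v)) =
        untwisted_bracket u (\<psi> (D v)) + untwisted_bracket (\<psi> (D u)) v)"
proof -
  have "(\<forall>u v. D (bracket u v) =
            bracket (\<phi> u) (Ad \<psi> D v) + bracket (Ad \<psi> D u) (\<phi> v)) \<longleftrightarrow>
        (\<forall>u v. D (bracket (\<psi> u) (\<psi> v)) = bracket u (\<psi> (D v)) + bracket (\<psi> (D u)) v)"
    (is "?L \<longleftrightarrow> ?R")
  proof
    show ?R if ?L
      using that by (simp add: Ad_def inv_psi)
    show ?L if ?R
    proof (intro allI)
      fix u v
      show "D (bracket u v) = bracket (\<phi> u) (Ad \<psi> D v) + bracket (Ad \<psi> D u) (\<phi> v)"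
        using that [rule_format, of "\<phi> u" "\<phi> v"] by (simp add: Ad_def inv_psi)
    qed
  qed
  then show ?thesis
    unfolding Der_def untwisted_bracket_def
    by (simp add: psi_eq_iff psi_bracket phi_rules phi_bracket)
qed

lemma Der_linear: "D \<in> Derivations \<Longrightarrow> Vector_Spaces.linear scale scale D"
  by (simp add: Der_def)

lemmas Der_rules = linear_rules [OF Der_linear]

lemma Der_untwisted:
  "D \<in> Derivations \<Longrightarrow>
   \<psi> (D (untwisted_bracket u v)) =
     untwisted_bracket u (\<psi> (D v)) + untwisted_bracket (\<psi> (D u)) v"
  by (simp add: Der_iff_untwisted)

lemma ad_in_Der: "ad bracket u \<in> Derivations"
  unfolding Der_iff_untwisted ad_def
  using bracket_linear_right untwisted_bracket_Leibniz [of u]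
  by (simp flip: untwisted_bracket_def)

text \<open>Conjugating a derivation by an automorphism gives a derivation.\<close>
lemma Ad_in_Der:
  assumes "D \<in> Derivations"
  shows "Ad \<phi> D \<in> Derivations"
proof -
  have conj: "\<psi> (Ad \<phi> D x) = \<phi> (\<psi> (D (\<psi> x)))" for x
    by (simp add: Ad_def)
  have "\<psi> (Ad \<phi> D (untwisted_bracket u v)) =
      untwisted_bracket u (\<psi> (Ad \<phi> D v)) + untwisted_bracket (\<psi> (Ad \<phi> D u)) v" for u v
    unfolding conj psi_untwisted_bracket Der_untwisted [OF assms]
    by (simp only: phi_rules phi_untwisted_bracket phi_psi)
  moreover have "Vector_Spaces.linear scale scale (Ad \<phi> D)"
    by (rule linear_endomorphismI) (simp_all add: Ad_def phi_rules psi_rules Der_rules [OF assms])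
  ultimately show ?thesis by (simp add: Der_iff_untwisted)
qed

text \<open>
  With \<open>F = \<phi>\<inverse> \<circ> D\<close> and \<open>G = \<phi>\<inverse> \<circ> E\<close>, the map \<open>\<phi>\<inverse> \<circ> [D, E]\<close> is the conjugate of \<open>F G - G F\<close>
  by \<open>\<phi>\<close>, and the mixed terms \<open>{F a, G b}\<close> cancel in \<open>F G - G F\<close>.
\<close>
lemma twisted_commutator_in_Der:
  assumes "D \<in> Derivations" "E \<in> Derivations"
  shows "twisted_commutator \<phi> D E \<in> Derivations"
proof -
  let ?F = "\<lambda>x. \<psi> (D x)" and ?G = "\<lambda>x. \<psi> (E x)"
  let ?C = "\<lambda>x. ?F (?G x) - ?G (?F x)"
  have conj: "\<psi> (twisted_commutator \<phi> D E x) = \<phi> (?C (\<psi> x))" for x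
    by (simp add: twisted_commutator_def psi_rules phi_rules)
  have "?C (untwisted_bracket a b) = untwisted_bracket a (?C b) + untwisted_bracket (?C a) b" for a b
    using assms by (simp add: Der_untwisted psi_rules Der_rules untwisted_bracket_linear_rules)
  then have "\<psi> (twisted_commutator \<phi> D E (untwisted_bracket u v)) =
      untwisted_bracket u (\<psi> (twisted_commutator \<phi> D E v)) +
      untwisted_bracket (\<psi> (twisted_commutator \<phi> D E u)) v" for u v
    unfolding conj psi_untwisted_bracket
    by (simp only: phi_rules phi_untwisted_bracket phi_psi)
  moreover have "Vector_Spaces.linear scale scale (twisted_commutator \<phi> D E)"
    using assms
    by (intro linear_endomorphismI)
      (simp_all add: twisted_commutator_def phi_rules psi_rules Der_rules scale_right_diff_distrib)
  ultimately show ?thesis by (simp add: Der_iff_untwisted)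
qed


section \<open>The Hom-Lie 2-algebra of derivations\<close>

lemma vector_space_fun_scale: "vector_space (fun_scale scale)"
  by unfold_locales
    (simp_all add: fun_scale_def fun_eq_iff scale_right_distrib scale_left_distrib)

lemma Der_subspace: "module.subspace (fun_scale scale) Derivations"
proof -
  interpret F: vector_space "fun_scale scale" by (rule vector_space_fun_scale)
  show ?thesis
  proof (rule F.subspaceI)
    show "0 \<in> Derivations"
      unfolding Der_iff_untwisted
      by (auto intro: linear_endomorphismI simp: psi_rules untwisted_bracket_linear_rules)
  next
    fix D E assume "D \<in> Derivations" "E \<in> Derivations"
    then show "D + E \<in> Derivations"
      unfolding Der_iff_untwisted
      by (auto intro!: linear_endomorphismI
          simp: linear_rules psi_rules untwisted_bracket_linear_rules scale_right_distrib)
  next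
    fix c D assume "D \<in> Derivations"
    then show "fun_scale scale c D \<in> Derivations"
      unfolding Der_iff_untwisted
      by (auto intro!: linear_endomorphismI simp: fun_scale_def linear_rules psi_rules
          untwisted_bracket_linear_rules scale_right_distrib scale_left_commute)
  qed
qed

text \<open>This is \<open>[F, {u, \<cdot>}] = {F u, \<cdot>}\<close>, a rearrangement of the Leibniz rule, twisted by \<open>\<phi>\<close>.\<close>
lemma ad_derivation_apply:
  assumes "D \<in> Derivations"
  shows "ad bracket (D u) = twisted_commutator \<phi> D (ad bracket u)"
proof
  fix v
  have "\<psi> (D (untwisted_bracket u (\<psi> v))) - untwisted_bracket u (\<psi> (D (\<psi> v))) =
      untwisted_bracket (\<psi> (D u)) (\<psi> v)"
    by (simp add: Der_untwisted [OF assms])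
  then have "\<phi> (\<phi> (\<psi> (D (untwisted_bracket u (\<psi> v))) - untwisted_bracket u (\<psi> (D (\<psi> v))))) =
      bracket (D u) v"
    by (simp add: phi_untwisted_bracket) (simp add: untwisted_bracket_def psi_bracket)
  then show "ad bracket (D u) v = twisted_commutator \<phi> D (ad bracket u) v"
    by (simp add: ad_def twisted_commutator_def untwisted_bracket_def phi_rules)
qed

lemma strict_hom_lie_2_algebra_Der:
  "strict_hom_lie_2_algebra scale (fun_scale scale) UNIV Derivations (ad bracket)
     (twisted_commutator \<phi>) (\<lambda>D u. D u) (\<lambda>u D. - D u) (Ad \<phi>) \<phi>"
proof -
  interpret F: vector_space "fun_scale scale" by (rule vector_space_fun_scale)
  note fun_simps = fun_eq_iff ad_def Ad_def twisted_commutator_def fun_scale_def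
    phi_rules psi_rules Der_rules bracket_left_rules bracket_right_rules
  show ?thesis
    unfolding strict_hom_lie_2_algebra_def
  proof unfold_locales
    show "F.subspace Derivations" by (rule Der_subspace)
    show "linear_on scale (fun_scale scale) UNIV Derivations (ad bracket)"
      unfolding linear_on_def using ad_in_Der by (simp add: fun_simps)
    show "bilinear_on (fun_scale scale) (fun_scale scale) (fun_scale scale)
        Derivations Derivations Derivations (twisted_commutator \<phi>)"
      unfolding bilinear_on_def linear_on_def
      using twisted_commutator_in_Der by (simp add: fun_simps scale_right_diff_distrib)
    show "bilinear_on (fun_scale scale) scale scale Derivations UNIV UNIV (\<lambda>D u. D u)"
      "bilinear_on scale (fun_scale scale) scale UNIV Derivations UNIV (\<lambda>u D. - D u)"
      unfolding bilinear_on_def linear_on_def by (simp_all add: fun_simps)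
    show "linear_on (fun_scale scale) (fun_scale scale) Derivations Derivations (Ad \<phi>)"
      unfolding linear_on_def using Ad_in_Der by (simp add: fun_simps)
    show "linear_on scale scale UNIV UNIV \<phi>"
      unfolding linear_on_def by (simp add: phi_rules)
    show "trilinear_on (fun_scale scale) scale Derivations UNIV (\<lambda>_ _ _. 0)"
      unfolding trilinear_on_def linear_on_def by simp
    show "Ad \<phi> (ad bracket m) = ad bracket (\<phi> m)" for m
      by (simp add: fun_simps phi_bracket)
    show "ad bracket (D u) = twisted_commutator \<phi> D (ad bracket u)" if "D \<in> Derivations" for D u
      using that by (rule ad_derivation_apply)
    show "ad bracket m n = - ad bracket n m" for m n
      unfolding ad_def by (rule bracket_skew)
  qed (simp_all add: fun_simps)
qed

end

theorem theorem3p8: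
  fixes scale :: "'k::field \<Rightarrow> 'h::ab_group_add \<Rightarrow> 'h"
    and bracket :: "'h \<Rightarrow> 'h \<Rightarrow> 'h"
    and \<phi> :: "'h \<Rightarrow> 'h"
  assumes "hom_lie_algebra scale bracket \<phi>"
    and "bij \<phi>"
  shows "strict_hom_lie_2_algebra scale (fun_scale scale)
           UNIV (Der scale bracket \<phi>)
           (ad bracket)
           (twisted_commutator \<phi>) (\<lambda>D u. D u) (\<lambda>u D. - D u)
           (Ad \<phi>) \<phi>"
proof -
  interpret regular_hom_lie_algebra scale bracket \<phi>
    using assms by (simp add: regular_hom_lie_algebra_def regular_hom_lie_algebra_axioms_def)
  show ?thesis by (rule strict_hom_lie_2_algebra_Der)
qed

end
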